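(* Let $G$ be a graph and let $C$ be (the vertex set of) a connected component of $G$ with $|C|\ge 2\delta(G)$. If $G[C]$ does not contain a Hamiltonian path, then either there exists a path $P_1$ in $G[C]$ such that $N(v)\subseteq V(P_1)$ for every $v\in C\setminus V(P_1)$, or there exist two vertex-disjoint paths $P_1,P_2$ with $|V(P_1)|+|V(P_2)|>3\delta(G)$.
   Context: $\delta(G)$ denotes the minimum degree of $G$. *)

theory Defs
  imports "Graph_Theory.Graph_Theory"
begin

text \<open>
  A finite simple undirected graph is a symmetric finite digraph without loops and parallel
  arcs (locale \<^locale>\<open>graph\<close>); an edge is a pair of opposite arcs. A path is a
  nonempty list of distinct vertices, consecutive ones being adjacent
  (\<^const>\<open>vpath\<close>); a single vertex is a path.
\<close>

definition neighborhood :: "('a, 'b) pre_digraph \<Rightarrow> 'a \<Rightarrow> 'a set" where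
  "neighborhood G v = {w. v \<rightarrow>\<^bsub>G\<^esub> w}"

text \<open>
  As there are no parallel arcs, the out-degree of a vertex is its number of neighbours.
  The minimum is unspecified for the graph without vertices.
\<close>

definition min_degree :: "('a, 'b) pre_digraph \<Rightarrow> nat" where
  "min_degree G = Min (out_degree G ` verts G)"

text \<open>
  The vertex sets of the maximal connected subgraphs; \<^const>\<open>connected\<close> excludes the
  graph without vertices, so components are nonempty.
\<close>

definition component_verts :: "('a, 'b) pre_digraph \<Rightarrow> 'a set set" where
  "component_verts G = verts ` {H. pre_digraph.max_subgraph G connected H}"

definition hamiltonian_path :: "('a, 'b) pre_digraph \<Rightarrow> 'a list \<Rightarrow> bool" where
  "hamiltonian_path G p \<longleftrightarrow> vpath p G \<and> set p = verts G"

end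

theory Submission
  imports Defs
begin

text \<open>
  Take a longest path \<open>P\<close> of \<open>G[C]\<close> and a longest path \<open>Q\<close> of \<open>G[C] - P\<close>. The vertices of \<open>P\<close>
  do not span a cycle, since otherwise connectivity would give a longer path; hence
  \<open>|P| > 2 \<delta>\<close> by the rotation argument of Dirac and Ore. If \<open>Q\<close> is a single vertex, then \<open>P\<close>
  is as wanted. Otherwise let \<open>q = |Q| \<ge> 2\<close>, and assume \<open>q \<le> \<delta>\<close>. Each end of \<open>Q\<close> has at least
  \<open>\<delta> + 1 - q\<close> neighbours on \<open>P\<close>, none of them among the first or last \<open>q\<close> vertices. By maximality
  of \<open>P\<close>, neighbours of the same end are not consecutive on \<open>P\<close>, and distinct neighbours of
  different ends are separated by at least \<open>q \<ge> 2\<close> vertices. So three consecutive vertices of \<open>P\<close>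
  receive at most two edges from the ends of \<open>Q\<close>, which forces
  \<open>|P| - 2 q > 3 (\<delta> - q)\<close>.
\<close>

section \<open>Counting separated sets of positions\<close>

lemma card_sum_le_2_window:
  fixes A B :: "nat set"
  assumes "A \<subseteq> {t..<t + 3}" "B \<subseteq> {t..<t + 3}"
    and sepA: "\<And>i. i \<in> A \<Longrightarrow> Suc i \<notin> A" and sepB: "\<And>i. i \<in> B \<Longrightarrow> Suc i \<notin> B"
    and sep: "\<And>i j. i \<in> A \<Longrightarrow> j \<in> B \<Longrightarrow> i \<noteq> j \<Longrightarrow> i + 2 < j \<or> j + 2 < i"
  shows "card A + card B \<le> 2"
proof -
  \<comment> \<open>Without consecutive elements, a subset of a window of three positions is
    contained in the middle one or in the two outer ones.\<close>
  have le2: "card X \<le> 2" if "X \<subseteq> {t..<t + 3}" "\<And>i. i \<in> X \<Longrightarrow> Suc i \<notin> X" for X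
  proof -
    have "X \<subseteq> {t + 1} \<or> X \<subseteq> {t, t + 2}"
    proof (cases "t + 1 \<in> X")
      case True
      then have "X \<subseteq> {t + 1}"
        using that(1) that(2)[of t] that(2)[of "t + 1"]
        by (auto simp: subset_iff le_less_Suc_eq numeral_eq_Suc less_Suc_eq)
      then show ?thesis ..
    next
      case False
      then have "X \<subseteq> {t, t + 2}"
        using that(1) by (auto simp: subset_iff numeral_eq_Suc less_Suc_eq)
      then show ?thesis ..
    qed
    then show ?thesis
    proof
      assume "X \<subseteq> {t + 1}"
      from card_mono[OF _ this] show ?thesis by simp
    next
      assume "X \<subseteq> {t, t + 2}"
      from card_mono[OF _ this] show ?thesis by simp
    qed
  qed
  show ?thesis
  proof (cases "A = {} \<or> B = {}")
    case True
    then show ?thesis using le2[of A] le2[of B] assms by auto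
  next
    case False
    then obtain a b where ab: "a \<in> A" "b \<in> B" by auto
    \<comment> \<open>Distinct positions in the window differ by at most 2, which \<open>sep\<close>
      forbids; so if both sets are nonempty, they are the same singleton.\<close>
    have eq: "i = j" if "i \<in> A" "j \<in> B" for i j
    proof (rule ccontr)
      assume "i \<noteq> j"
      from sep[OF that this] assms(1,2) that show False by fastforce
    qed
    have "A \<subseteq> {b}" "B \<subseteq> {a}" using eq ab by auto
    then have "card A \<le> card {b}" "card B \<le> card {a}"
      using card_mono[of "{b}" A] card_mono[of "{a}" B] by simp_all
    then show ?thesis by simp
  qed
qed

text \<open>Induction on \<open>n\<close>, cutting off the last window of three. The sets will be
  the positions on \<open>P\<close> of the neighbours of the two ends of \<open>Q\<close>; common
  neighbours are possible, so \<open>sep\<close> constrains distinct positions only.\<close>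

lemma card_sum_le_windows:
  fixes A B :: "nat set"
  assumes "A \<subseteq> {m..<m + 3 * n}" "B \<subseteq> {m..<m + 3 * n}"
    and sepA: "\<And>i. i \<in> A \<Longrightarrow> Suc i \<notin> A" and sepB: "\<And>i. i \<in> B \<Longrightarrow> Suc i \<notin> B"
    and sep: "\<And>i j. i \<in> A \<Longrightarrow> j \<in> B \<Longrightarrow> i \<noteq> j \<Longrightarrow> i + 2 < j \<or> j + 2 < i"
  shows "card A + card B \<le> 2 * n"
  using assms
proof (induction n arbitrary: A B)
  case 0
  then show ?case by simp
next
  case (Suc n)
  let ?I = "{m..<m + 3 * n}" and ?W = "{m + 3 * n..<m + 3 * n + 3}"
  have split: "card X = card (X \<inter> ?I) + card (X \<inter> ?W)" if "X \<subseteq> {m..<m + 3 * Suc n}" for X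
  proof -
    have "X = (X \<inter> ?I) \<union> (X \<inter> ?W)" using that by auto
    then have "card X = card ((X \<inter> ?I) \<union> (X \<inter> ?W))" by simp
    also have "\<dots> = card (X \<inter> ?I) + card (X \<inter> ?W)"
      by (rule card_Un_disjoint) auto
    finally show ?thesis .
  qed
  have "card (A \<inter> ?I) + card (B \<inter> ?I) \<le> 2 * n"
    by (rule Suc.IH) (use Suc.prems in auto)
  moreover have "card (A \<inter> ?W) + card (B \<inter> ?W) \<le> 2"
  proof (rule card_sum_le_2_window[where t = "m + 3 * n"])
    show "i + 2 < j \<or> j + 2 < i" if "i \<in> A \<inter> ?W" "j \<in> B \<inter> ?W" "i \<noteq> j" for i j
      using Suc.prems(5)[of i j] that by blast
  qed (use Suc.prems(3,4) in auto)
  ultimately show ?case using split[of A] split[of B] Suc.prems(1,2) by simp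
qed

section \<open>Paths and longest paths for an adjacency relation\<close>

definition path_in :: "('a \<Rightarrow> 'a \<Rightarrow> bool) \<Rightarrow> 'a set \<Rightarrow> 'a list \<Rightarrow> bool" where
  "path_in E S xs \<longleftrightarrow> xs \<noteq> [] \<and> distinct xs \<and> set xs \<subseteq> S \<and> successively E xs"

text \<open>The set \<open>S\<close> is a parameter because two instances occur: \<open>V\<close>
  for \<open>P\<close>, and \<open>V - set P\<close> for \<open>Q\<close>.\<close>

definition longest_path_in :: "('a \<Rightarrow> 'a \<Rightarrow> bool) \<Rightarrow> 'a set \<Rightarrow> 'a list \<Rightarrow> bool" where
  "longest_path_in E S xs \<longleftrightarrow>
    path_in E S xs \<and> (\<forall>ys. path_in E S ys \<longrightarrow> length ys \<le> length xs)"

lemma longest_path_inD: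
  assumes "longest_path_in E S xs"
  shows "path_in E S xs" "xs \<noteq> []" "distinct xs" "set xs \<subseteq> S" "successively E xs"
  using assms by (auto simp: longest_path_in_def path_in_def)

lemma longest_path_in_length_le:
  "longest_path_in E S xs \<Longrightarrow> path_in E S ys \<Longrightarrow> length ys \<le> length xs"
  by (simp add: longest_path_in_def)

lemma longest_path_in_exists:
  assumes "finite S" "path_in E S ys"
  obtains xs where "longest_path_in E S xs"
proof -
  have "length xs \<le> card S" if "path_in E S xs" for xs
    using that assms(1) by (metis path_in_def card_mono distinct_card)
  then have "\<exists>xs. path_in E S xs \<and> (\<forall>ys. path_in E S ys \<longrightarrow> length ys \<le> length xs)"
    by (intro Lattices_Big.ex_has_greatest_nat[where k = ys and b = "Suc (card S)"])
      (use assms(2) in \<open>auto simp: less_Suc_eq_le\<close>)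
  then show thesis using that by (auto simp: longest_path_in_def)
qed

text \<open>An abstraction of \<open>G[C]\<close>. Connectedness takes the form of a cut condition
  because it is applied to \<open>set P\<close>, where it yields an edge leaving the path.\<close>

locale connected_finite_graph =
  fixes V :: "'a set" and E :: "'a \<Rightarrow> 'a \<Rightarrow> bool"
  assumes finite_V: "finite V"
    and sym: "E x y \<Longrightarrow> E y x"
    and irrefl: "\<not> E x x"
    and E_V: "E x y \<Longrightarrow> x \<in> V"
    and cut: "S \<subset> V \<Longrightarrow> S \<noteq> {} \<Longrightarrow> \<exists>x \<in> S. \<exists>y \<in> V - S. E x y"
begin

lemma sym_iff: "E x y \<longleftrightarrow> E y x"
  using sym by blast

lemma successively_rev_E: "successively E (rev xs) \<longleftrightarrow> successively E xs"
  by (simp add: sym_iff[symmetric])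

lemma path_in_rev: "path_in E S (rev xs) \<longleftrightarrow> path_in E S xs"
  by (simp add: path_in_def successively_rev_E del: successively_rev)

lemma path_in_append:
  assumes "path_in E S xs" "path_in E S ys" "set xs \<inter> set ys = {}" "E (last xs) (hd ys)"
  shows "path_in E S (xs @ ys)"
  using assms by (auto simp: path_in_def successively_append_iff)

lemma path_in_appendD:
  assumes "path_in E S (xs @ ys)"
  shows "xs \<noteq> [] \<Longrightarrow> path_in E S xs" "ys \<noteq> [] \<Longrightarrow> path_in E S ys" "set xs \<inter> set ys = {}"
  using assms by (auto simp: path_in_def successively_append_iff)

lemma path_in_take:
  assumes "path_in E S xs" "0 < i"
  shows "path_in E S (take i xs)"
proof (rule path_in_appendD(1))
  show "path_in E S (take i xs @ drop i xs)" using assms by simp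
qed (use assms in \<open>auto simp: path_in_def\<close>)

lemma path_in_drop:
  assumes "path_in E S xs" "i < length xs"
  shows "path_in E S (drop i xs)"
proof (rule path_in_appendD(2))
  show "path_in E S (take i xs @ drop i xs)" using assms by simp
qed (use assms in auto)

lemma path_in_mono: "path_in E S xs \<Longrightarrow> S \<subseteq> T \<Longrightarrow> path_in E T xs"
  by (auto simp: path_in_def)

lemma path_in_singleton: "x \<in> S \<Longrightarrow> path_in E S [x]"
  by (simp add: path_in_def)

section \<open>The Dirac-Ore bound for a longest path\<close>

lemma longest_path_ends_not_adjacent:
  assumes P: "longest_path_in E V P" and "set P \<noteq> V"
  shows "\<not> E (last P) (hd P)"
proof
  assume cyc: "E (last P) (hd P)"
  note P' = longest_path_inD[OF P]
  have "set P \<subset> V" "set P \<noteq> {}" using assms(2) P' by auto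
  then obtain x y where xy: "x \<in> set P" "y \<in> V - set P" "E x y" using cut by blast
  obtain ys zs where P_eq: "P = ys @ x # zs" using split_list[OF xy(1)] by blast
  let ?ys = "ys @ [x]"
  have P_eq': "P = ?ys @ zs" using P_eq by simp
  have ys: "path_in E V ?ys" using path_in_appendD(1)[of V ?ys zs] P'(1) P_eq by simp
  have ysy: "path_in E V (?ys @ [y])"
  proof (rule path_in_append[OF ys])
    show "path_in E V [y]" using xy by (auto intro: path_in_singleton)
  qed (use xy P_eq in auto)
  \<comment> \<open>The edge between the ends closes \<open>P\<close> to a cycle, which is opened
    right after \<open>x\<close> and extended by \<open>y\<close>: one vertex more than
    \<open>P\<close>.\<close>
  have "path_in E V (zs @ ?ys @ [y])"
  proof (cases "zs = []")
    case True
    then show ?thesis using ysy by simp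
  next
    case False
    show ?thesis
    proof (rule path_in_append)
      show "path_in E V zs" using path_in_appendD(2)[of V ?ys zs] P'(1) P_eq False by simp
      show "path_in E V (?ys @ [y])" by (fact ysy)
      show "set zs \<inter> set (?ys @ [y]) = {}" using P'(3) xy P_eq by auto
      show "E (last zs) (hd (?ys @ [y]))"
        using cyc False unfolding P_eq by (cases ys) auto
    qed
  qed
  from longest_path_in_length_le[OF P this] show False unfolding P_eq by simp
qed

text \<open>Reversing the part of \<open>P\<close> up to position \<open>i\<close> gives, by the
  edge from \<open>hd P\<close> to \<open>P ! Suc i\<close>, another longest path on the same
  vertices, with ends \<open>P ! i\<close> and \<open>last P\<close>. These are not adjacent
  either.\<close>

lemma longest_path_rotation:
  assumes P: "longest_path_in E V P" and "set P \<noteq> V"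
    and i: "Suc i < length P" "E (hd P) (P ! Suc i)"
  shows "\<not> E (P ! i) (last P)"
proof
  assume E: "E (P ! i) (last P)"
  note P' = longest_path_inD[OF P]
  let ?R = "rev (take (Suc i) P) @ drop (Suc i) P"
  have ne: "take (Suc i) P \<noteq> []" using P' by simp
  have "path_in E V ?R"
  proof (rule path_in_append)
    show "path_in E V (rev (take (Suc i) P))"
      unfolding path_in_rev using P'(1) by (simp add: path_in_take)
    show "path_in E V (drop (Suc i) P)" using P'(1) i by (simp add: path_in_drop)
    show "set (rev (take (Suc i) P)) \<inter> set (drop (Suc i) P) = {}"
      using P'(3) by (simp add: set_take_disj_set_drop_if_distinct)
    show "E (last (rev (take (Suc i) P))) (hd (drop (Suc i) P))"
      using i ne by (simp add: last_rev hd_drop_conv_nth)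
  qed
  then have R: "longest_path_in E V ?R"
    using P i by (auto simp: longest_path_in_def)
  have "set ?R = set P"
    by (metis append_take_drop_id set_append set_rev)
  then have "\<not> E (last ?R) (hd ?R)"
    using longest_path_ends_not_adjacent[OF R] assms(2) by simp
  moreover have "hd ?R = P ! i" using ne i by (simp add: hd_rev last_conv_nth)
  moreover have "last ?R = last P" using i by simp
  ultimately show False using E sym by simp
qed

text \<open>Otherwise \<open>w\<close> could be put in front of \<open>P\<close>.\<close>

lemma longest_path_neighbor_hd:
  assumes P: "longest_path_in E S P" and "E (hd P) w" "w \<in> S"
  shows "w \<in> set P"
proof (rule ccontr)
  assume "w \<notin> set P"
  have "path_in E S ([w] @ P)"
    by (rule path_in_append)
      (use assms longest_path_inD[OF P] \<open>w \<notin> set P\<close> in \<open>auto simp: path_in_singleton intro: sym\<close>)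
  from longest_path_in_length_le[OF P this] show False by simp
qed

lemma longest_path_in_rev: "longest_path_in E S (rev P) \<longleftrightarrow> longest_path_in E S P"
  by (simp add: longest_path_in_def path_in_rev)

lemma longest_path_neighbor_last:
  assumes P: "longest_path_in E S P" and "E (last P) w" "w \<in> S"
  shows "w \<in> set P"
  using longest_path_neighbor_hd[of S "rev P" w] assms longest_path_inD[OF P]
  by (simp add: longest_path_in_rev hd_rev)

lemma finite_neighbors: "finite {w. E v w}"
  by (rule finite_subset[OF _ finite_V]) (use sym E_V in blast)

text \<open>Neighbours of \<open>hd P\<close> are recorded in \<open>?I\<close> by the position
  before them, neighbours of \<open>last P\<close> in \<open>?J\<close> by their own position.
  Rotation makes the two sets disjoint.\<close>

lemma longest_path_length_gt:
  assumes P: "longest_path_in E V P" and ne: "set P \<noteq> V"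
    and deg: "\<And>v. v \<in> V \<Longrightarrow> d \<le> card {w. E v w}"
  shows "2 * d < length P"
proof -
  note P' = longest_path_inD[OF P]
  let ?I = "{i. Suc i < length P \<and> E (hd P) (P ! Suc i)}"
  let ?J = "{i. Suc i < length P \<and> E (P ! i) (last P)}"
  have ends: "hd P \<in> V" "last P \<in> V" using P' by auto
  have fin: "finite ?I" "finite ?J" by (rule finite_subset[of _ "{..<length P}"]; auto)+
  have "{w. E (hd P) w} \<subseteq> (\<lambda>i. P ! Suc i) ` ?I"
  proof
    fix w assume w: "w \<in> {w. E (hd P) w}"
    then have "w \<in> set P" using longest_path_neighbor_hd[OF P] sym E_V by blast
    then obtain j where j: "j < length P" "P ! j = w" by (auto simp: in_set_conv_nth)
    have "j \<noteq> 0" using j w irrefl P'(2) by (metis hd_conv_nth mem_Collect_eq)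
    then obtain i where "j = Suc i" by (cases j) auto
    then show "w \<in> (\<lambda>i. P ! Suc i) ` ?I" using j w by auto
  qed
  then have I: "d \<le> card ?I"
    by (rule le_trans[OF deg[OF ends(1)] surj_card_le[OF fin(1)]])
  have "{w. E (last P) w} \<subseteq> (\<lambda>i. P ! i) ` ?J"
  proof
    fix w assume w: "w \<in> {w. E (last P) w}"
    then have "w \<in> set P" using longest_path_neighbor_last[OF P] sym E_V by blast
    then obtain j where j: "j < length P" "P ! j = w" by (auto simp: in_set_conv_nth)
    have "j \<noteq> length P - 1" using j w irrefl P'(2) by (metis last_conv_nth mem_Collect_eq)
    then have "Suc j < length P" using j by linarith
    then show "w \<in> (\<lambda>i. P ! i) ` ?J" using j w sym by auto
  qed
  then have J: "d \<le> card ?J"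
    by (rule le_trans[OF deg[OF ends(2)] surj_card_le[OF fin(2)]])
  have "?I \<inter> ?J = {}" using longest_path_rotation[OF P ne] by auto
  then have "card ?I + card ?J = card (?I \<union> ?J)" using fin by (simp add: card_Un_disjoint)
  \<comment> \<open>The last position is in neither set; this makes the final inequality
    strict.\<close>
  also have "\<dots> \<le> card {..<length P - 1}" by (rule card_mono) auto
  finally show ?thesis using I J P'(2) by (cases P) auto
qed

section \<open>Attaching a second path to a longest path\<close>

lemma longest_path_detour:
  assumes P: "longest_path_in E V P" and Q: "path_in E V Q" "set P \<inter> set Q = {}"
    and ij: "i < j" "j < length P" "E (P ! i) (hd Q)" "E (P ! j) (last Q)"
  shows "i + length Q < j"
proof -
  note P' = longest_path_inD[OF P]
  have tQ: "set (take n P) \<inter> set Q = {}" "set Q \<inter> set (drop n P) = {}" for n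
    using Q(2) by (auto dest: in_set_takeD in_set_dropD)
  have tP: "take (Suc i) P \<noteq> []" using P' by simp
  \<comment> \<open>The detour leaves \<open>P\<close> at position \<open>i\<close>, runs through
    \<open>Q\<close> and returns at position \<open>j\<close>. It skips \<open>j - i - 1\<close>
    vertices, which by maximality are at least \<open>length Q\<close> many.\<close>
  have "path_in E V (Q @ drop j P)"
    by (rule path_in_append)
      (use Q P' ij tQ in \<open>auto simp: path_in_drop hd_drop_conv_nth intro: sym\<close>)
  then have "path_in E V (take (Suc i) P @ Q @ drop j P)"
  proof (rule path_in_append[rotated])
    show "path_in E V (take (Suc i) P)" using P'(1) by (simp add: path_in_take)
    show "set (take (Suc i) P) \<inter> set (Q @ drop j P) = {}"
      using tQ ij(1) P'(3) set_take_disj_set_drop_if_distinct[of P "Suc i" j] by auto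
    show "E (last (take (Suc i) P)) (hd (Q @ drop j P))"
      using ij Q tP by (simp add: path_in_def last_conv_nth)
  qed
  from longest_path_in_length_le[OF P this] ij show ?thesis by simp
qed

text \<open>Replacing by \<open>Q\<close> what follows position \<open>i\<close>, or by the reverse
  of \<open>Q\<close> what precedes it, cannot lengthen \<open>P\<close>.\<close>

lemma longest_path_attachment:
  assumes P: "longest_path_in E V P" and Q: "path_in E V Q" "set P \<inter> set Q = {}"
    and i: "i < length P" "E (P ! i) (hd Q)"
  shows "length Q \<le> i" "i + length Q < length P"
proof -
  note P' = longest_path_inD[OF P]
  have tP: "take (Suc i) P \<noteq> []" using P' by simp
  have "path_in E V (take (Suc i) P @ Q)"
  proof (rule path_in_append)
    show "path_in E V (take (Suc i) P)" using P'(1) by (simp add: path_in_take)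
    show "set (take (Suc i) P) \<inter> set Q = {}" using Q(2) by (auto dest: in_set_takeD)
    show "E (last (take (Suc i) P)) (hd Q)" using i tP by (simp add: last_conv_nth)
  qed (fact Q(1))
  from longest_path_in_length_le[OF P this] i show "i + length Q < length P" by simp
  have "path_in E V (rev Q @ drop i P)"
  proof (rule path_in_append)
    show "path_in E V (rev Q)" using Q(1) by (simp add: path_in_rev)
    show "path_in E V (drop i P)" using P'(1) i by (simp add: path_in_drop)
    show "set (rev Q) \<inter> set (drop i P) = {}" using Q(2) by (auto dest: in_set_dropD)
    show "E (last (rev Q)) (hd (drop i P))"
      using i Q(1) by (simp add: path_in_def last_rev hd_drop_conv_nth sym)
  qed
  from longest_path_in_length_le[OF P this] i show "length Q \<le> i" by simp
qed

text \<open>By maximality of \<open>Q\<close>, the neighbours of \<open>x\<close> off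
  \<open>P\<close> lie on \<open>Q\<close>; as \<open>x\<close> itself is excluded, they number at
  most \<open>length Q - 1\<close>.\<close>

lemma longest_path_neighbors_card:
  assumes Q: "longest_path_in E (V - set P) Q" and x: "x = hd Q \<or> x = last Q"
  shows "card {w. E x w} < card {i. i < length P \<and> E (P ! i) x} + length Q"
proof -
  note Q' = longest_path_inD[OF Q]
  let ?A = "{i. i < length P \<and> E (P ! i) x}"
  have xQ: "x \<in> set Q" using x Q'(2) by auto
  have "{w. E x w} \<subseteq> (\<lambda>i. P ! i) ` ?A \<union> (set Q - {x})"
  proof
    fix w assume w: "w \<in> {w. E x w}"
    show "w \<in> (\<lambda>i. P ! i) ` ?A \<union> (set Q - {x})"
    proof (cases "w \<in> set P")
      case True
      then obtain i where "i < length P" "P ! i = w" by (auto simp: in_set_conv_nth)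
      then show ?thesis using w sym by auto
    next
      case False
      then have "w \<in> V - set P" using w sym E_V by blast
      then have "w \<in> set Q"
        using x w longest_path_neighbor_hd[OF Q] longest_path_neighbor_last[OF Q] by auto
      then show ?thesis using w irrefl by auto
    qed
  qed
  then have "card {w. E x w} \<le> card ((\<lambda>i. P ! i) ` ?A \<union> (set Q - {x}))"
    by (rule card_mono[rotated]) auto
  also have "\<dots> \<le> card ((\<lambda>i. P ! i) ` ?A) + card (set Q - {x})" by (rule card_Un_le)
  also have "\<dots> \<le> card ?A + card (set Q - {x})" by (simp add: card_image_le)
  also have "card (set Q - {x}) < card (set Q)" using xQ by (intro card_Diff1_less) auto
  also have "card (set Q) = length Q" using Q'(3) by (rule distinct_card)
  finally show ?thesis by simp
qed

lemma longest_paths_length_gt: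
  assumes P: "longest_path_in E V P" and ne: "set P \<noteq> V"
    and Q: "longest_path_in E (V - set P) Q" "2 \<le> length Q"
    and deg: "\<And>v. v \<in> V \<Longrightarrow> d \<le> card {w. E v w}"
  shows "3 * d < length P + length Q"
proof (cases "length Q \<le> d")
  case False
  then show ?thesis using longest_path_length_gt[OF P ne deg] by simp
next
  case True
  note Q' = longest_path_inD[OF Q(1)]
  have QV: "path_in E V Q" "path_in E V (rev Q)"
    using Q'(1) path_in_mono[of _ Q V] by (auto simp: path_in_rev)
  have disj: "set P \<inter> set Q = {}" "set P \<inter> set (rev Q) = {}" using Q'(4) by auto
  have ends: "hd Q \<in> V - set P" "last Q \<in> V - set P"
    using Q'(2,4) hd_in_set last_in_set by blast+
  define nbrs where "nbrs x = {i. i < length P \<and> E (P ! i) x}" for x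
  define k where "k = d - length Q"
  have card: "k < card (nbrs x)" if "x = hd Q \<or> x = last Q" for x
  proof -
    have "x \<in> V" using that ends by auto
    then show ?thesis
      using longest_path_neighbors_card[OF Q(1) that] deg[of x] True
      unfolding nbrs_def k_def by linarith
  qed
  \<comment> \<open>A detour through the single vertex \<open>x\<close> must skip at least one
    vertex.\<close>
  have sep: "Suc i \<notin> nbrs x" if "i \<in> nbrs x" "x \<in> V - set P" for i x
    using longest_path_detour[OF P path_in_singleton[of x V], of i "Suc i"] that
    by (auto simp: nbrs_def)
  show ?thesis
  proof (rule ccontr)
    assume "\<not> ?thesis"
    \<comment> \<open>If the claim fails, removing \<open>length Q\<close> positions at each end of
      \<open>P\<close> leaves at most \<open>3 * k\<close>. These windows admit \<open>2 * k\<close>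
      positions in total, but each end of \<open>Q\<close> has more than \<open>k\<close>.\<close>
    then have bound: "length P \<le> 2 * length Q + 3 * k" using True by (simp add: k_def)
    have sub: "nbrs (hd Q) \<subseteq> {length Q..<length Q + 3 * k}"
      "nbrs (last Q) \<subseteq> {length Q..<length Q + 3 * k}"
      using longest_path_attachment[OF P QV(1) disj(1)]
        longest_path_attachment[OF P QV(2) disj(2)] bound Q'(2)
      by (fastforce simp: nbrs_def hd_rev)+
    \<comment> \<open>The detour runs through \<open>Q\<close> or its reverse, according to which
      position comes first; the gap exceeds \<open>length Q\<close>, which is at least 2.\<close>
    have cross: "i + 2 < j \<or> j + 2 < i"
      if "i \<in> nbrs (hd Q)" "j \<in> nbrs (last Q)" "i \<noteq> j" for i j
    proof (cases "i < j")
      case True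
      then show ?thesis
        using longest_path_detour[OF P QV(1) disj(1), of i j] that Q(2) by (auto simp: nbrs_def)
    next
      case False
      then show ?thesis
        using longest_path_detour[OF P QV(2) disj(2), of j i] that Q(2) Q'(2)
        by (auto simp: nbrs_def hd_rev last_rev)
    qed
    have "card (nbrs (hd Q)) + card (nbrs (last Q)) \<le> 2 * k"
      by (rule card_sum_le_windows[OF sub]) (use sep ends cross in auto)
    then show False using card[of "hd Q"] card[of "last Q"] by simp
  qed
qed

theorem dominating_path_or_two_long_paths:
  assumes "V \<noteq> {}" and ham: "\<And>P. path_in E V P \<Longrightarrow> set P \<noteq> V"
    and deg: "\<And>v. v \<in> V \<Longrightarrow> d \<le> card {w. E v w}"
  shows "(\<exists>P. path_in E V P \<and> (\<forall>v \<in> V - set P. {w. E v w} \<subseteq> set P)) \<or>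
    (\<exists>P Q. path_in E V P \<and> path_in E V Q \<and> set P \<inter> set Q = {} \<and>
      card (set P) + card (set Q) > 3 * d)"
proof -
  obtain x where "x \<in> V" using assms(1) by auto
  then obtain P where P: "longest_path_in E V P"
    using longest_path_in_exists[OF finite_V path_in_singleton] by blast
  note P' = longest_path_inD[OF P]
  show ?thesis
  proof (cases "\<forall>v \<in> V - set P. {w. E v w} \<subseteq> set P")
    case True
    then show ?thesis using P'(1) by blast
  next
    case False
    then obtain v w where vw: "v \<in> V - set P" "E v w" "w \<notin> set P" by auto
    then have "w \<in> V" "v \<noteq> w" using sym E_V irrefl by blast+
    \<comment> \<open>An edge off \<open>P\<close> is itself a path with two vertices, so a longest
      path off \<open>P\<close> has at least two, as the length bound demands.\<close>
    then have edge: "path_in E (V - set P) [v, w]" using vw by (simp add: path_in_def)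
    obtain Q where Q: "longest_path_in E (V - set P) Q"
      using longest_path_in_exists[OF _ edge] finite_V by blast
    note Q' = longest_path_inD[OF Q]
    have "2 \<le> length Q" using longest_path_in_length_le[OF Q edge] by simp
    then have "3 * d < length P + length Q"
      using longest_paths_length_gt[OF P ham[OF P'(1)] Q] deg by simp
    moreover have "path_in E V Q" using Q'(1) by (rule path_in_mono) auto
    moreover have "set P \<inter> set Q = {}" using Q'(4) by auto
    moreover have "card (set P) = length P" "card (set Q) = length Q"
      using P'(3) Q'(3) by (simp_all add: distinct_card)
    ultimately have "path_in E V P \<and> path_in E V Q \<and> set P \<inter> set Q = {} \<and>
        card (set P) + card (set Q) > 3 * d"
      using P'(1) by simp
    then show ?thesis by blast
  qed
qed

end

section \<open>Transfer to digraphs and their components\<close>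

lemma vpath_iff_path_in: "vpath p G \<longleftrightarrow> path_in (\<lambda>u v. u \<rightarrow>\<^bsub>G\<^esub> v) (verts G) p"
proof -
  have "set (vwalk_arcs p) \<subseteq> arcs_ends G \<longleftrightarrow> successively (\<lambda>u v. u \<rightarrow>\<^bsub>G\<^esub> v) p"
    by (induction p rule: vwalk_arcs.induct) auto
  then show ?thesis by (auto simp: vpath_def vwalk_def path_in_def)
qed

text \<open>Adding arcs preserves connectedness, so a maximal connected subgraph is induced; by
  symmetry it is strongly connected. Membership in \<open>sccs_verts\<close> then describes
  components by mutual reachability in \<open>G\<close>.\<close>

lemma (in sym_digraph) component_verts_sccs_verts:
  assumes "C \<in> component_verts G"
  shows "C \<in> sccs_verts"
proof -
  obtain H where H: "max_subgraph connected H" and C: "C = verts H"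
    using assms by (auto simp: component_verts_def)
  have "arc_mono connected"
    unfolding arc_mono_def
    by (metis spanning_def subgraphE wf_digraph.connected_spanning_imp_connected)
  then have ind: "induced_subgraph H G" using H by (rule induced_subgraphI_arc_mono[rotated])
  interpret H: sym_digraph H using ind by (rule induced_graph_imp_graph)
  have "H \<in> sccs"
  proof (rule in_sccsI[OF ind])
    show "strongly_connected H"
      using H.sym_arcs H by (auto simp: max_subgraph_def intro: H.symmetric_connected_imp_strongly_connected)
    show "\<not> (\<exists>K. induced_subgraph K G \<and> strongly_connected K \<and> verts H \<subset> verts K)"
    proof
      assume "\<exists>K. induced_subgraph K G \<and> strongly_connected K \<and> verts H \<subset> verts K"
      then obtain K where K: "induced_subgraph K G" "strongly_connected K" "verts H \<subset> verts K"
        by blast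
      interpret K: sym_digraph K using K(1) by (rule induced_graph_imp_graph)
      have "connected K"
        using K(2) by (intro K.connectedI)
          (simp_all add: strongly_connected_def K.reachable_mk_symmetric_eq[OF K.sym_arcs])
      \<comment> \<open>\<open>K\<close> is induced and contains all vertices of \<open>H\<close>,
        hence all its arcs; so \<open>K\<close> would contradict the maximality of
        \<open>H\<close>.\<close>
      moreover have "subgraph H K"
      proof (rule subgraphI)
        have eq: "tail H = tail G" "head H = head G" "tail K = tail G" "head K = head G"
          using ind K(1) by (simp_all add: induced_subgraph_def subgraph_def compatible_def)
        show "arcs H \<subseteq> arcs K"
        proof
          fix e assume "e \<in> arcs H"
          with H.tail_in_verts H.head_in_verts have "tail H e \<in> verts K" "head H e \<in> verts K"
            using K(3) by blast+
          then show "e \<in> arcs K"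
            using \<open>e \<in> arcs H\<close> ind K(1) unfolding eq
            by (auto simp: induced_subgraph_def subgraph_def)
        qed
        show "compatible K H" by (simp add: compatible_def eq)
      qed (use K(3) H.wf_digraph K.wf_digraph in auto)
      ultimately show False using H K by (auto simp: max_subgraph_def)
    qed
  qed
  then show ?thesis using C in_sccs_vertsI_sccs by blast
qed

lemma dominates_induce_subgraph_iff: "u \<rightarrow>\<^bsub>G \<restriction> C\<^esub> v \<longleftrightarrow> u \<rightarrow>\<^bsub>G\<^esub> v \<and> u \<in> C \<and> v \<in> C"
  by (auto simp: arcs_ends_def arc_to_ends_def)

text \<open>By symmetry \<open>u\<close> and \<open>v\<close> reach each other, and a strong
  component contains every vertex mutually reachable with one of its own.\<close>

lemma (in sym_digraph) component_verts_closed: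
  assumes "C \<in> component_verts G" "u \<in> C" "u \<rightarrow> v"
  shows "v \<in> C"
proof -
  have "u \<rightarrow>\<^sup>* v" using assms(3) by (rule reachable_adjI)
  moreover from this have "v \<rightarrow>\<^sup>* u" by (rule symmetric_reachable[OF sym_arcs])
  ultimately show ?thesis
    using component_verts_sccs_verts[OF assms(1)] assms(2) unfolding sccs_verts_def by blast
qed

lemma (in sym_digraph) component_verts_subset:
  assumes "C \<in> component_verts G"
  shows "C \<noteq> {}" "C \<subseteq> verts G"
proof -
  have C: "C \<in> sccs_verts" using assms by (rule component_verts_sccs_verts)
  then show "C \<noteq> {}" by (simp add: sccs_verts_def)
  show "C \<subseteq> verts G"
    using C reachable_in_verts(1) by (fastforce simp: sccs_verts_def)
qed

lemma (in graph) connected_finite_graph_component: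
  assumes "C \<in> component_verts G"
  shows "connected_finite_graph C (\<lambda>u v. u \<rightarrow>\<^bsub>G \<restriction> C\<^esub> v)"
proof
  note C = component_verts_subset[OF assms]
  show "finite C" using C(2) finite_verts by (rule finite_subset)
  show "y \<rightarrow>\<^bsub>G \<restriction> C\<^esub> x" if "x \<rightarrow>\<^bsub>G \<restriction> C\<^esub> y" for x y
    using that graph_symmetric by (auto simp: dominates_induce_subgraph_iff)
  show "\<not> x \<rightarrow>\<^bsub>G \<restriction> C\<^esub> x" for x
    using adj_not_same by (auto simp: dominates_induce_subgraph_iff)
  show "x \<in> C" if "x \<rightarrow>\<^bsub>G \<restriction> C\<^esub> y" for x y
    using that by (simp add: dominates_induce_subgraph_iff)
  show "\<exists>x \<in> S. \<exists>y \<in> C - S. x \<rightarrow>\<^bsub>G \<restriction> C\<^esub> y" if "S \<subset> C" "S \<noteq> {}" for S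
  proof (rule ccontr)
    assume no_edge: "\<not> ?thesis"
    obtain x y where xy: "x \<in> S" "y \<in> C - S" using \<open>S \<subset> C\<close> \<open>S \<noteq> {}\<close> by blast
    then have "x \<rightarrow>\<^sup>* y"
      using component_verts_sccs_verts[OF assms] that(1) unfolding sccs_verts_def by blast
    \<comment> \<open>A walk from \<open>x\<close> stays in \<open>C\<close> because components are
      closed under adjacency, and stays in \<open>S\<close> because no edge leads from
      \<open>S\<close> to \<open>C - S\<close>.\<close>
    then have "y \<in> S"
    proof (induction rule: reachable_induct)
      case base
      then show ?case using xy by simp
    next
      case (step u v)
      then show ?case
        using no_edge that(1) component_verts_closed[OF assms, of u v]
        by (auto simp: dominates_induce_subgraph_iff)
    qed
    then show False using xy by simp
  qed
qed

text \<open>Two arcs leaving \<open>v\<close> with the same head would be parallel, so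
  \<open>head G\<close> is injective on \<open>out_arcs G v\<close>.\<close>

lemma (in nomulti_digraph) out_degree_eq_card_neighborhood:
  "out_degree G v = card (neighborhood G v)"
proof -
  have "neighborhood G v = head G ` out_arcs G v"
    by (auto simp: neighborhood_def arcs_ends_def arc_to_ends_def)
  moreover have "inj_on (head G) (out_arcs G v)"
    by (rule inj_onI) (auto intro: no_multi_arcs simp: arc_to_ends_def)
  ultimately show ?thesis by (simp add: out_degree_def card_image)
qed

theorem theorem3p13:
  fixes G :: "('a, 'b) pre_digraph" and C :: "'a set"
  assumes "graph G"
    and "C \<in> component_verts G"
    and "card C \<ge> 2 * min_degree G"
    and "\<not> (\<exists>p. hamiltonian_path (G \<restriction> C) p)"
  shows "(\<exists>P1. vpath P1 (G \<restriction> C) \<and> (\<forall>v \<in> C - set P1. neighborhood G v \<subseteq> set P1)) \<or>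
    (\<exists>P1 P2. vpath P1 (G \<restriction> C) \<and> vpath P2 (G \<restriction> C) \<and> set P1 \<inter> set P2 = {} \<and>
      card (set P1) + card (set P2) > 3 * min_degree G)"
proof -
  interpret graph G by fact
  interpret H: connected_finite_graph C "\<lambda>u v. u \<rightarrow>\<^bsub>G \<restriction> C\<^esub> v"
    using assms(2) by (rule connected_finite_graph_component)
  note C = component_verts_subset[OF assms(2)]
  \<comment> \<open>As \<open>C\<close> is closed under adjacency, passing to \<open>G[C]\<close>
    loses no neighbours; so the minimum degree of \<open>G\<close> also bounds the degrees in
    \<open>G[C]\<close>.\<close>
  have nbrs: "{w. v \<rightarrow>\<^bsub>G \<restriction> C\<^esub> w} = neighborhood G v" if "v \<in> C" for v
    using that component_verts_closed[OF assms(2)]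
    by (auto simp: neighborhood_def dominates_induce_subgraph_iff)
  have deg: "min_degree G \<le> card {w. v \<rightarrow>\<^bsub>G \<restriction> C\<^esub> w}" if "v \<in> C" for v
    using that C(2) unfolding nbrs[OF that] min_degree_def
    by (auto simp: out_degree_eq_card_neighborhood[symmetric] intro!: Min_le)
  have ham: "set P \<noteq> C" if "path_in (\<lambda>u v. u \<rightarrow>\<^bsub>G \<restriction> C\<^esub> v) C P" for P
    using assms(4) that by (auto simp: hamiltonian_path_def vpath_iff_path_in)
  have "(\<forall>v \<in> C - set P. {w. v \<rightarrow>\<^bsub>G \<restriction> C\<^esub> w} \<subseteq> set P) \<longleftrightarrow>
      (\<forall>v \<in> C - set P. neighborhood G v \<subseteq> set P)" for P
    by (rule ball_cong) (simp_all add: nbrs)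
  with H.dominating_path_or_two_long_paths[OF C(1) ham deg] show ?thesis
    by (simp only: vpath_iff_path_in induce_subgraph_verts)
qed

end
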